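(* Assume that $\phi$ satisfies the Osgood condition $\int_0^1\frac{ds}{\phi(s)}=\infty$. Let $u\in C(Q_4(0,1))$ be a non-negative function which is a viscosity supersolution of $P^-_{\lambda,\Lambda}(D^2u)-u_t\le\phi(|Du|)$ in $Q_4(0,1)$ and a viscosity subsolution of $P^+_{\lambda,\Lambda}(D^2u)-u_t\ge-\phi(|Du|)$ in $Q_4(0,1)$. If $u(0,0)=0$, then $$u(x,0)=0\qquad\text{for all } x\in B_1.$$
   Context: Points of space-time are $(x,t)\in\mathbb{R}^n\times\mathbb{R}$; $|\cdot|$ is the Euclidean norm and $|x|_\infty=\max_i|x_i|$. $B_r\subset\mathbb{R}^n$ is the open Euclidean ball of radius $r$ centered at the origin. Parabolic cubes are $Q_\rho(x_0,t_0)=\{x\in\mathbb{R}^n:|x-x_0|_\infty<\rho\}\times(t_0-\rho^2,t_0]$; thus $Q_4(0,1)$ is centered at $x_0=0$, $t_0=1$. $Du$, $D^2u$ are the gradient and Hessian in $x$, $u_t$ is the time derivative. Fixed constants $0<\lambda\le\Lambda$. For a real symmetric $n\times n$ matrix $M$ with eigenvalues $e_i$: $P^-_{\lambda,\Lambda}(M)=\lambda\sum_{e_i>0}e_i+\Lambda\sum_{e_i<0}e_i$ and $P^+_{\lambda,\Lambda}(M)=\Lambda\sum_{e_i>0}e_i+\lambda\sum_{e_i<0}e_i$. Standing assumptions on the nonlinearity: $\phi:[0,\infty)\to[0,\infty)$ has the form $\phi(t)=\eta(t)t$ and (P1) $\phi$ is increasing, locally Lipschitz continuous in $(0,\infty)$,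 and $\phi(t)\ge t$ for every $t\ge0$; moreover $\eta:(0,\infty)\to[1,\infty)$ is nonincreasing on $(0,1)$ and nondecreasing on $[1,\infty)$; (P2) $\lim_{t\to\infty}\frac{t\eta'(t)}{\eta(t)}\log(\eta(t))=0$; (P3) there is a constant $\Lambda_0$ such that $\eta(st)\le\Lambda_0\eta(s)\eta(t)$ for all $s,t\in(0,\infty)$. Viscosity solutions: a lower semicontinuous $u:Q_r(x_0,t_0)\to\mathbb{R}$ is a viscosity supersolution of $P^-_{\lambda,\Lambda}(D^2u)-u_t\le\phi(|Du|)$ in $Q_r(x_0,t_0)$ if, whenever $(x,t)\in Q_r(x_0,t_0)$ and $\psi\in C^2(Q_r(x_0,t_0))$ satisfy $\psi\le u$ and $\psi(x,t)=u(x,t)$, one has $P^-_{\lambda,\Lambda}(D^2\psi(x,t))-\psi_t(x,t)\le\phi(|D\psi(x,t)|)$. An upper semicontinuous $u$ is a viscosity subsolution of $P^+_{\lambda,\Lambda}(D^2u)-u_t\ge-\phi(|Du|)$ in $Q_r(x_0,t_0)$ if, whenever $(x,t)\in Q_r(x_0,t_0)$ and $\psi\in C^2(Q_r(x_0,t_0))$ satisfy $\psi\ge u$ and $\psi(x,t)=u(x,t)$, one has $P^+_{\lambda,\Lambda}(D^2\psi(x,t))-\psi_t(x,t)\ge-\phi(|D\psi(x,t)|)$. *)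

theory Defs
  imports "HOL-Analysis.Analysis"
begin

text \<open>
  Space-time is the product of \<open>real ^ 'n\<close> and \<open>real\<close>; \<open>norm\<close> on \<open>real ^ 'n\<close> is Euclidean and
  \<open>infnorm\<close> is the maximum norm.
\<close>

definition par_cube :: "real \<Rightarrow> (real ^ 'n) \<times> real \<Rightarrow> ((real ^ 'n) \<times> real) set" where
  "par_cube \<rho> z0 = {(x, t). infnorm (x - fst z0) < \<rho> \<and> snd z0 - \<rho>\<^sup>2 < t \<and> t \<le> snd z0}"

definition eigenspace :: "real ^ 'n ^ 'n \<Rightarrow> real \<Rightarrow> (real ^ 'n) set" where
  "eigenspace M e = {v. M *v v = e *\<^sub>R v}"

definition eigenvalues :: "real ^ 'n ^ 'n \<Rightarrow> real set" where
  "eigenvalues M = {e. \<exists>v. v \<noteq> 0 \<and> M *v v = e *\<^sub>R v}"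

text \<open>
  The sums in the Pucci operators run over the eigenvalues with multiplicity. The matrices of
  interest are symmetric, so the multiplicity of an eigenvalue is the dimension of its eigenspace.
\<close>

definition pucci_minus :: "real \<Rightarrow> real \<Rightarrow> real ^ 'n ^ 'n \<Rightarrow> real" where
  "pucci_minus lam Lam M =
     lam * (\<Sum>e \<in> {e \<in> eigenvalues M. e > 0}. real (dim (eigenspace M e)) * e) +
     Lam * (\<Sum>e \<in> {e \<in> eigenvalues M. e < 0}. real (dim (eigenspace M e)) * e)"

definition pucci_plus :: "real \<Rightarrow> real \<Rightarrow> real ^ 'n ^ 'n \<Rightarrow> real" where
  "pucci_plus lam Lam M =
     Lam * (\<Sum>e \<in> {e \<in> eigenvalues M. e > 0}. real (dim (eigenspace M e)) * e) +
     lam * (\<Sum>e \<in> {e \<in> eigenvalues M. e < 0}. real (dim (eigenspace M e)) * e)"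

text \<open>
  \<open>C2_derivs Q f f' f''\<close>: \<open>f\<close> is of class C2 on \<open>Q\<close> in the space-time variable, with first and
  second derivatives \<open>f'\<close> and \<open>f''\<close>. Derivatives are taken within \<open>Q\<close>, hence are one-sided in time
  at the top of a parabolic cube. Such a cube is convex with nonempty interior, so \<open>f'\<close> and \<open>f''\<close>
  are determined by \<open>f\<close> on it.
\<close>

definition C2_derivs ::
  "((real ^ 'n) \<times> real) set \<Rightarrow> ((real ^ 'n) \<times> real \<Rightarrow> real) \<Rightarrow>
   ((real ^ 'n) \<times> real \<Rightarrow> (((real ^ 'n) \<times> real) \<Rightarrow>\<^sub>L real)) \<Rightarrow>
   ((real ^ 'n) \<times> real \<Rightarrow> (((real ^ 'n) \<times> real) \<Rightarrow>\<^sub>L (((real ^ 'n) \<times> real) \<Rightarrow>\<^sub>L real))) \<Rightarrow> bool" where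
  "C2_derivs Q f f' f'' \<longleftrightarrow>
     (\<forall>z\<in>Q. (f has_derivative blinfun_apply (f' z)) (at z within Q)) \<and>
     (\<forall>z\<in>Q. (f' has_derivative blinfun_apply (f'' z)) (at z within Q)) \<and>
     continuous_on Q f''"

text \<open>The spatial gradient, the time derivative and the spatial Hessian read off from the total
  derivatives at a point.\<close>

definition grad_x :: "(((real ^ 'n) \<times> real) \<Rightarrow>\<^sub>L real) \<Rightarrow> real ^ 'n" where
  "grad_x A = (\<chi> i. blinfun_apply A (axis i 1, 0))"

definition deriv_t :: "(((real ^ 'n) \<times> real) \<Rightarrow>\<^sub>L real) \<Rightarrow> real" where
  "deriv_t A = blinfun_apply A (0, 1)"

definition hess_x ::
  "(((real ^ 'n) \<times> real) \<Rightarrow>\<^sub>L (((real ^ 'n) \<times> real) \<Rightarrow>\<^sub>L real)) \<Rightarrow> real ^ 'n ^ 'n" where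
  "hess_x B = (\<chi> i j. blinfun_apply (blinfun_apply B (axis i 1, 0)) (axis j 1, 0))"

definition lsc_on :: "'a::topological_space set \<Rightarrow> ('a \<Rightarrow> real) \<Rightarrow> bool" where
  "lsc_on Q u \<longleftrightarrow> (\<forall>z\<in>Q. \<forall>c. c < u z \<longrightarrow> (\<forall>\<^sub>F w in at z within Q. c < u w))"

definition usc_on :: "'a::topological_space set \<Rightarrow> ('a \<Rightarrow> real) \<Rightarrow> bool" where
  "usc_on Q u \<longleftrightarrow> (\<forall>z\<in>Q. \<forall>c. u z < c \<longrightarrow> (\<forall>\<^sub>F w in at z within Q. u w < c))"

definition viscosity_supersolution ::
  "real \<Rightarrow> real \<Rightarrow> (real \<Rightarrow> real) \<Rightarrow> ((real ^ 'n) \<times> real) set \<Rightarrow> ((real ^ 'n) \<times> real \<Rightarrow> real) \<Rightarrow> bool"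
where
  "viscosity_supersolution lam Lam \<phi> Q u \<longleftrightarrow>
     lsc_on Q u \<and>
     (\<forall>z\<in>Q. \<forall>\<psi> \<psi>' \<psi>''. C2_derivs Q \<psi> \<psi>' \<psi>'' \<and> (\<forall>w\<in>Q. \<psi> w \<le> u w) \<and> \<psi> z = u z \<longrightarrow>
        pucci_minus lam Lam (hess_x (\<psi>'' z)) - deriv_t (\<psi>' z) \<le> \<phi> (norm (grad_x (\<psi>' z))))"

definition viscosity_subsolution ::
  "real \<Rightarrow> real \<Rightarrow> (real \<Rightarrow> real) \<Rightarrow> ((real ^ 'n) \<times> real) set \<Rightarrow> ((real ^ 'n) \<times> real \<Rightarrow> real) \<Rightarrow> bool"
where
  "viscosity_subsolution lam Lam \<phi> Q u \<longleftrightarrow>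
     usc_on Q u \<and>
     (\<forall>z\<in>Q. \<forall>\<psi> \<psi>' \<psi>''. C2_derivs Q \<psi> \<psi>' \<psi>'' \<and> (\<forall>w\<in>Q. u w \<le> \<psi> w) \<and> \<psi> z = u z \<longrightarrow>
        pucci_plus lam Lam (hess_x (\<psi>'' z)) - deriv_t (\<psi>' z) \<ge> - \<phi> (norm (grad_x (\<psi>' z))))"

text \<open>
  The functions \<open>\<phi>\<close> and \<open>\<eta>\<close> are total; only their values on \<open>[0, \<infinity>)\<close> and \<open>(0, \<infinity>)\<close>,
  respectively, matter. ``Increasing'' is understood in the weak sense.
\<close>

definition cond_P1 :: "(real \<Rightarrow> real) \<Rightarrow> (real \<Rightarrow> real) \<Rightarrow> bool" where
  "cond_P1 \<phi> \<eta> \<longleftrightarrow>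
     mono_on {0..} \<phi> \<and>
     (\<forall>t>0. \<exists>r>0. \<exists>L. L-lipschitz_on (cball t r \<inter> {0<..}) \<phi>) \<and>
     (\<forall>t\<ge>0. \<phi> t \<ge> t) \<and>
     (\<forall>t>0. \<eta> t \<ge> 1) \<and>
     antimono_on {0<..<1} \<eta> \<and>
     mono_on {1..} \<eta>"

text \<open>
  Since \<open>\<phi>\<close> is only locally Lipschitz, the derivative of \<open>\<eta>\<close> need exist only almost
  everywhere; the limit is taken along the points at which \<open>\<eta>\<close> is differentiable.
\<close>

definition cond_P2 :: "(real \<Rightarrow> real) \<Rightarrow> bool" where
  "cond_P2 \<eta> \<longleftrightarrow>
     ((\<lambda>t. t * deriv \<eta> t / \<eta> t * ln (\<eta> t)) \<longlongrightarrow> 0)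
       (inf at_top (principal {t. \<eta> field_differentiable (at t)}))"

definition cond_P3 :: "(real \<Rightarrow> real) \<Rightarrow> bool" where
  "cond_P3 \<eta> \<longleftrightarrow> (\<exists>\<Lambda>0. \<forall>s>0. \<forall>t>0. \<eta> (s * t) \<le> \<Lambda>0 * \<eta> s * \<eta> t)"

text \<open>
  The representation of \<open>\<phi>\<close> through \<open>\<eta>\<close> is required on \<open>(0, \<infinity>)\<close>, the domain of \<open>\<eta>\<close>.
  At \<open>0\<close> the Osgood condition and monotonicity force \<open>\<phi> 0 = 0\<close>.
\<close>

definition admissible_nonlinearity :: "(real \<Rightarrow> real) \<Rightarrow> (real \<Rightarrow> real) \<Rightarrow> bool" where
  "admissible_nonlinearity \<phi> \<eta> \<longleftrightarrow>
     (\<forall>t\<ge>0. \<phi> t \<ge> 0) \<and> (\<forall>t>0. \<phi> t = \<eta> t * t) \<and> cond_P1 \<phi> \<eta> \<and> cond_P2 \<eta> \<and> cond_P3 \<eta>"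

definition osgood :: "(real \<Rightarrow> real) \<Rightarrow> bool" where
  "osgood \<phi> \<longleftrightarrow> (\<integral>\<^sup>+ s \<in> {0<..<1}. ennreal (1 / \<phi> s) \<partial>lborel) = \<infinity>"

end

theory Submission
  imports Defs
begin

text \<open>
  Only the supersolution property is needed, through a barrier for the horizontal propagation of
  zeros. If \<open>u (x1, 0) > 0\<close>, take \<open>\<psi> = h \<circ> g\<close> with
  \<open>g (x, t) = \<bar>x1\<bar>\<^sup>2 - \<bar>x - x1\<bar>\<^sup>2 - K t\<^sup>2\<close>. The ellipsoid \<open>g \<ge> 0\<close> has the origin on its boundary, and
  for large \<open>K\<close> its part near the axis \<open>x = x1\<close> lies where \<open>u\<close> exceeds a positive constant.
  The profile \<open>h\<close> solves \<open>h'' = B \<phi>(2 h')\<close> with \<open>h' > 0\<close> as small as desired; the Osgood condition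
  is what keeps \<open>h'\<close> from vanishing. As \<open>u \<ge> 0 > \<psi>\<close> outside the ellipsoid and \<open>u = \<psi> = 0\<close> at the
  origin, \<open>u - \<psi>\<close> attains a nonpositive global minimum in the ellipsoid away from the axis. There
  \<open>\<bar>Dg\<bar>\<close> is bounded below, so for large \<open>B\<close> the term \<open>h''\<close> makes \<open>\<psi>\<close> a strict subsolution,
  a contradiction.
\<close>

section \<open>The Osgood condition and the profile equation\<close>

lemma isCont_of_local_lipschitz:
  fixes \<phi> :: "real \<Rightarrow> real"
  assumes "\<forall>t>0. \<exists>r>0. \<exists>L. L-lipschitz_on (cball t r \<inter> {0<..}) \<phi>" and "0 < t"
  shows "isCont \<phi> t"
proof -
  obtain r L where r: "r > 0" and L: "L-lipschitz_on (cball t r \<inter> {0<..}) \<phi>"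
    using assms by blast
  have "continuous_on (ball t r \<inter> {0<..}) \<phi>"
    by (rule continuous_on_subset[OF lipschitz_on_continuous_on[OF L]]) auto
  moreover have "open (ball t r \<inter> {0<..})" by auto
  ultimately show ?thesis
    using r assms(2) continuous_on_eq_continuous_at by fastforce
qed

text \<open>If the primitive \<open>\<Phi>\<close> of \<open>1 / \<phi>\<close> stayed above
  \<open>C\<close> near 0, the integrals of \<open>1 / \<phi>\<close> over intervals shrinking down
  to 0 would be bounded by \<open>\<Phi> 1 - C\<close>, and monotone convergence would make the
  Osgood integral finite.\<close>

lemma osgood_primitive_unbounded:
  fixes \<phi> \<Phi> :: "real \<Rightarrow> real"
  assumes osg: "osgood \<phi>"
    and cont: "\<And>s. 0 < s \<Longrightarrow> isCont \<phi> s"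
    and pos: "\<And>s. 0 < s \<Longrightarrow> 0 < \<phi> s"
    and der: "\<And>s. 0 < s \<Longrightarrow> (\<Phi> has_real_derivative 1 / \<phi> s) (at s)"
    and "0 < e"
  shows "\<exists>s. 0 < s \<and> s < e \<and> \<Phi> s < C"
proof (rule ccontr)
  assume "\<not> ?thesis"
  then have neg: "\<And>s. 0 < s \<Longrightarrow> s < e \<Longrightarrow> C \<le> \<Phi> s" by force
  have mono: "\<Phi> s \<le> \<Phi> t" if "0 < s" "s \<le> t" for s t
  proof (rule DERIV_nonneg_imp_nondecreasing[OF that(2)])
    fix x assume "s \<le> x" "x \<le> t"
    then have "x > 0" using that by auto
    then show "\<exists>y. (\<Phi> has_real_derivative y) (at x) \<and> 0 \<le> y"
      using der pos by (intro exI[of _ "1 / \<phi> x"]) (auto intro: less_imp_le)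
  qed
  \<comment> \<open>Monotonicity carries the bound from \<open>(0, e)\<close> to all positive
    arguments, so that it applies at every cut-off point below, wherever it lies relative to
    \<open>e\<close>.\<close>
  have lower: "C \<le> \<Phi> s" if "0 < s" for s
    using neg[of "min s (e/2)"] mono[of "min s (e/2)" s] that \<open>0 < e\<close>
    by (simp add: min_less_iff_disj)
  define a where "a n = 1 / (real n + 1)" for n
  have a: "0 < a n" "a n \<le> 1" for n by (auto simp: a_def)
  have a_mono: "a n \<le> a m" if "m \<le> n" for m n
    using that by (auto simp: a_def frac_le)
  have a_lim: "\<exists>n. a n \<le> s" if s: "0 < s" for s :: real
  proof -
    obtain n where "1 / real (Suc n) < s" using s nat_approx_posE by blast
    then show ?thesis by (intro exI[of _ n]) (auto simp: a_def add.commute)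
  qed
  \<comment> \<open>The cut-off at \<open>a n\<close> stays away from the singularity at 0; the
    supremum over \<open>n\<close> recovers \<open>1 / \<phi>\<close> on
    \<open>(0, 1]\<close>.\<close>
  define f where "f n s = ennreal (1 / \<phi> s) * indicator {a n..1} s" for n s
  have f_int: "integral\<^sup>N lborel (f n) \<le> ennreal (\<Phi> 1 - C)" for n
  proof -
    have "((\<lambda>s. 1 / \<phi> s) has_integral (\<Phi> 1 - \<Phi> (a n))) {a n..1}"
    proof (rule fundamental_theorem_of_calculus[OF a(2)])
      fix x assume "x \<in> {a n..1}"
      then have "0 < x" using a(1)[of n] by auto
      then show "(\<Phi> has_vector_derivative 1 / \<phi> x) (at x within {a n..1})"
        using der has_real_derivative_iff_has_vector_derivative has_vector_derivative_at_within by blast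
    qed
    then have "integral\<^sup>N lborel (f n) = ennreal (\<Phi> 1 - \<Phi> (a n))"
      unfolding f_def
    proof (rule nn_integral_has_integral_lebesgue'[rotated])
      fix x assume "x \<in> {a n..1}"
      then have "0 < x" using a(1)[of n] by auto
      then show "0 \<le> 1 / \<phi> x" using pos[of x] by auto
    qed
    also have "\<dots> \<le> ennreal (\<Phi> 1 - C)"
      using lower[OF a(1)] by (intro ennreal_leI) auto
    finally show ?thesis .
  qed
  have f_meas: "f n \<in> borel_measurable lborel" for n
  proof -
    have "continuous_on {a n..1} (\<lambda>s. 1 / \<phi> s)"
    proof (intro continuous_at_imp_continuous_on ballI)
      fix x assume "x \<in> {a n..1}"
      then have "0 < x" using a(1)[of n] by auto
      then show "isCont (\<lambda>s. 1 / \<phi> s) x"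
        using cont[of x] pos[of x] by (intro continuous_intros) auto
    qed
    then have "(\<lambda>s. indicator {a n..1} s *\<^sub>R (1 / \<phi> s)) \<in> borel_measurable borel"
      by (intro borel_measurable_continuous_on_indicator) auto
    then have "(\<lambda>s. ennreal (indicator {a n..1} s *\<^sub>R (1 / \<phi> s))) \<in> borel_measurable borel"
      by measurable
    moreover have "(\<lambda>s. ennreal (indicator {a n..1} s *\<^sub>R (1 / \<phi> s))) = f n"
      by (auto simp: f_def fun_eq_iff indicator_def)
    ultimately show ?thesis by simp
  qed
  have "incseq f"
    unfolding incseq_def le_fun_def f_def
    using a_mono by (auto intro!: mult_left_mono simp: indicator_def intro: order_trans)
  then have "integral\<^sup>N lborel (\<lambda>s. SUP n. f n s) = (SUP n. integral\<^sup>N lborel (f n))"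
    using f_meas by (rule nn_integral_monotone_convergence_SUP)
  also have "\<dots> \<le> ennreal (\<Phi> 1 - C)" by (intro SUP_least f_int)
  finally have bound: "integral\<^sup>N lborel (\<lambda>s. SUP n. f n s) \<le> ennreal (\<Phi> 1 - C)" .
  have "(\<integral>\<^sup>+ s \<in> {0<..<1}. ennreal (1 / \<phi> s) \<partial>lborel) \<le> integral\<^sup>N lborel (\<lambda>s. SUP n. f n s)"
  proof (rule nn_integral_mono)
    fix s :: real
    show "ennreal (1 / \<phi> s) * indicator {0<..<1} s \<le> (SUP n. f n s)"
    proof (cases "s \<in> {0<..<1}")
      case True
      then obtain n where "a n \<le> s" using a_lim by auto
      with True have "ennreal (1 / \<phi> s) * indicator {0<..<1} s = f n s"
        by (auto simp: f_def)
      then show ?thesis by (metis SUP_upper UNIV_I)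
    qed auto
  qed
  with bound osg show False
    unfolding osgood_def by (metis ennreal_neq_top infinity_ennreal_def neq_top_trans order_trans)
qed

text \<open>Separation of variables: \<open>p\<close> is the inverse of a primitive of
  \<open>1 / (A * \<phi>)\<close>. By the Osgood condition this primitive tends to minus infinity at
  0, so the solution exists on the whole half-line below \<open>b\<close> without ever reaching
  0.\<close>

lemma osgood_flow:
  fixes \<phi> :: "real \<Rightarrow> real"
  assumes osg: "osgood \<phi>"
    and cont: "\<And>s. 0 < s \<Longrightarrow> isCont \<phi> s"
    and pos: "\<And>s. 0 < s \<Longrightarrow> 0 < \<phi> s"
    and "0 < A" "0 < e"
  obtains p where "\<And>y. y < b \<Longrightarrow> 0 < p y \<and> p y < e"
    and "\<And>y. y < b \<Longrightarrow> (p has_real_derivative A * \<phi> (p y)) (at y)"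
proof -
  have "\<exists>F. \<forall>x::real. (0::ereal) < x \<longrightarrow> x < \<infinity> \<longrightarrow> (F has_vector_derivative 1 / \<phi> x) (at x)"
  proof (rule einterval_antiderivative)
    fix x :: real assume "(0::ereal) < x"
    then have "0 < x" by simp
    then show "isCont (\<lambda>s. 1 / \<phi> s) x"
      using cont[of x] pos[of x] by (intro continuous_intros) auto
  qed auto
  then obtain \<Phi> where der: "\<And>s. 0 < s \<Longrightarrow> (\<Phi> has_real_derivative 1 / \<phi> s) (at s)"
    by (auto simp: has_real_derivative_iff_has_vector_derivative)
  have less: "\<Phi> s < \<Phi> t" if "0 < s" "s < t" for s t
  proof (rule DERIV_pos_imp_increasing[OF that(2)])
    fix x assume "s \<le> x" "x \<le> t"
    then have "x > 0" using that by auto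
    then show "\<exists>y. (\<Phi> has_real_derivative y) (at x) \<and> 0 < y"
      using der pos by (intro exI[of _ "1 / \<phi> x"]) auto
  qed
  \<comment> \<open>The constant is chosen so that \<open>f e = b\<close>; thus the values of
    \<open>f\<close> on \<open>(0, e)\<close> are exactly the numbers below
    \<open>b\<close>.\<close>
  define f where "f s = (\<Phi> s - \<Phi> e) / A + b" for s
  have f_der: "(f has_real_derivative 1 / (A * \<phi> s)) (at s)" if "0 < s" for s
    unfolding f_def using that der \<open>0 < A\<close> by (auto intro!: derivative_eq_intros)
  have f_cont: "continuous_on {0<..} f"
    using f_der by (auto intro!: continuous_at_imp_continuous_on DERIV_isCont)
  have f_less: "f s < f t" if "0 < s" "s < t" for s t
    using less[OF that] \<open>0 < A\<close> by (simp add: f_def divide_strict_right_mono)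
  have inj: "inj_on f {0<..}"
    by (rule linorder_inj_onI) (use f_less in \<open>fastforce\<close>)+
  define p where "p = inv_into {0<..} f"
  have p_f: "p (f s) = s" if "0 < s" for s
    using inj that by (simp add: p_def)
  have ex: "\<exists>s. 0 < s \<and> s < e \<and> f s = y" if "y < b" for y
  proof -
    obtain s where s: "0 < s" "s < e" "\<Phi> s < \<Phi> e + A * (y - b)"
      using osgood_primitive_unbounded[OF osg cont pos der \<open>0 < e\<close>] by blast
    have "f s \<le> y" using s \<open>0 < A\<close> by (simp add: f_def field_simps)
    moreover have fe: "f e = b" by (simp add: f_def)
    moreover have "continuous_on {s..e} f"
      by (rule continuous_on_subset[OF f_cont]) (use s in auto)
    ultimately obtain r where r: "s \<le> r" "r \<le> e" "f r = y"
      using IVT'[of f s y e] s \<open>y < b\<close> by auto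
    then have "r \<noteq> e" using \<open>y < b\<close> fe by auto
    with r s show ?thesis by (intro exI[of _ r]) auto
  qed
  show ?thesis
  proof
    show p: "0 < p y \<and> p y < e" if "y < b" for y
      using ex[OF that] p_f by auto
    show "(p has_real_derivative A * \<phi> (p y)) (at y)" if "y < b" for y
    proof -
      obtain s where s: "0 < s" "f s = y" using ex[OF \<open>y < b\<close>] by auto
      have "(p has_derivative (*) (A * \<phi> s)) (at (f s))"
      proof (rule has_derivative_inverse_strong[OF _ _ f_cont])
        show "(f has_derivative (*) (1 / (A * \<phi> s))) (at s)"
          using f_der[OF s(1)] by (simp add: has_field_derivative_def)
        show "(*) (1 / (A * \<phi> s)) \<circ> (*) (A * \<phi> s) = id"
          using pos[OF s(1)] \<open>0 < A\<close> by (auto simp: fun_eq_iff)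
      qed (use s p_f in auto)
      with s p_f show ?thesis by (auto simp: has_field_derivative_def)
    qed
  qed
qed

text \<open>With \<open>p = 2 * h'\<close> the equation becomes the first-order flow
  \<open>p' = 2 * B * \<phi> p\<close>. The factor 2 inside \<open>\<phi>\<close> anticipates the
  gradient of the barrier, whose length is at most \<open>2 * h'\<close>.\<close>

lemma osgood_profile:
  fixes \<phi> :: "real \<Rightarrow> real"
  assumes osg: "osgood \<phi>"
    and cont: "\<And>s. 0 < s \<Longrightarrow> isCont \<phi> s"
    and pos: "\<And>s. 0 < s \<Longrightarrow> 0 < \<phi> s"
    and "0 < B" "0 < e" "0 < b"
  obtains h h' where "h 0 = 0"
    and "\<And>y. y < b \<Longrightarrow> (h has_real_derivative h' y) (at y)"
    and "\<And>y. y < b \<Longrightarrow> (h' has_real_derivative B * \<phi> (2 * h' y)) (at y)"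
    and "\<And>y. y < b \<Longrightarrow> 0 < h' y \<and> h' y < e"
proof -
  obtain p where p: "\<And>y. y < b \<Longrightarrow> 0 < p y \<and> p y < 2 * e"
    and p_der: "\<And>y. y < b \<Longrightarrow> (p has_real_derivative 2 * B * \<phi> (p y)) (at y)"
    using osgood_flow[OF osg cont pos, of "2 * B" "2 * e" b] assms by auto
  have "\<exists>F. \<forall>x::real. -\<infinity> < ereal x \<longrightarrow> ereal x < ereal b \<longrightarrow>
      (F has_vector_derivative p x / 2) (at x)"
    by (rule einterval_antiderivative) (use p_der DERIV_isCont in \<open>auto intro!: continuous_intros\<close>)
  then obtain F where F: "\<And>y. y < b \<Longrightarrow> (F has_real_derivative p y / 2) (at y)"
    by (auto simp: has_real_derivative_iff_has_vector_derivative)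
  show ?thesis
  proof (rule that[of "\<lambda>y. F y - F 0" "\<lambda>y. p y / 2"])
    show "F 0 - F 0 = 0" by simp
    show "((\<lambda>y. F y - F 0) has_real_derivative p y / 2) (at y)" if "y < b" for y
      using F[OF that] by (auto intro!: derivative_eq_intros)
    show "((\<lambda>y. p y / 2) has_real_derivative B * \<phi> (2 * (p y / 2))) (at y)" if "y < b" for y
      using p_der[OF that] by (auto intro!: derivative_eq_intros)
    show "0 < p y / 2 \<and> p y / 2 < e" if "y < b" for y
      using p[OF that] by auto
  qed
qed

section \<open>Pucci operator of a rank-one perturbation of a multiple of the identity\<close>

text \<open>The spectrum lies in \<open>{a * (v \<bullet> v) + b, b}\<close>. Exact multiplicities
  can be avoided: the positive eigenvalue counts at least once, and the negative \<open>b\<close> at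
  most \<open>CARD('n)\<close> times.\<close>

lemma pucci_minus_rank_one_ge:
  fixes M :: "real ^ 'n ^ 'n"
  assumes M: "\<And>w. M *v w = (a * (v \<bullet> w)) *\<^sub>R v + b *\<^sub>R w"
    and "b < 0" "0 < a * (v \<bullet> v) + b" "0 \<le> lam" "0 \<le> Lam"
  shows "lam * (a * (v \<bullet> v) + b) + Lam * (real CARD('n) * b) \<le> pucci_minus lam Lam M"
proof -
  define c where "c = a * (v \<bullet> v) + b"
  have "v \<noteq> 0" using assms by auto
  have ev: "eigenvalues M \<subseteq> {c, b}"
  proof
    fix e assume "e \<in> eigenvalues M"
    then obtain w where w: "w \<noteq> 0" "(a * (v \<bullet> w)) *\<^sub>R v + b *\<^sub>R w = e *\<^sub>R w"
      by (auto simp: eigenvalues_def M)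
    \<comment> \<open>Pairing the eigenvalue equation with \<open>v\<close> leaves two cases:
      \<open>e = c\<close>, or \<open>w\<close> orthogonal to \<open>v\<close>, where the matrix
      acts as \<open>b\<close>.\<close>
    have "v \<bullet> ((a * (v \<bullet> w)) *\<^sub>R v + b *\<^sub>R w) = v \<bullet> (e *\<^sub>R w)" using w by simp
    then have "(c - e) * (v \<bullet> w) = 0"
      by (simp add: inner_add_right c_def algebra_simps)
    moreover have "e = b" if "v \<bullet> w = 0"
      using w that by simp
    ultimately show "e \<in> {c, b}" by auto
  qed
  have Mv: "M *v v = c *\<^sub>R v"
    by (simp add: M c_def algebra_simps)
  then have c: "c \<in> eigenvalues M" using \<open>v \<noteq> 0\<close> by (auto simp: eigenvalues_def)
  have "0 < c" using assms by (simp add: c_def)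
  have "{e \<in> eigenvalues M. e > 0} = {c}"
    using ev c \<open>0 < c\<close> \<open>b < 0\<close> by auto
  moreover have "1 \<le> dim (eigenspace M c)"
  proof -
    have "v \<in> eigenspace M c" using Mv by (simp add: eigenspace_def)
    then have "dim {v} \<le> dim (eigenspace M c)" by (intro dim_subset) auto
    then show ?thesis using \<open>v \<noteq> 0\<close> by simp
  qed
  ultimately have "c \<le> (\<Sum>e \<in> {e \<in> eigenvalues M. e > 0}. real (dim (eigenspace M e)) * e)"
    using \<open>0 < c\<close> by simp
  moreover have "real CARD('n) * b \<le> (\<Sum>e \<in> {e \<in> eigenvalues M. e < 0}. real (dim (eigenspace M e)) * e)"
  proof -
    have "dim (eigenspace M b) \<le> CARD('n)"
      using dim_subset_UNIV[of "eigenspace M b"] by simp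
    then have "real CARD('n) * b \<le> real (dim (eigenspace M b)) * b"
      using \<open>b < 0\<close> by (intro mult_right_mono_neg) auto
    moreover have "real CARD('n) * b \<le> 0"
      using \<open>b < 0\<close> by (simp add: mult_nonneg_nonpos)
    \<comment> \<open>The set is empty in dimension one, where \<open>c\<close> is the only
      eigenvalue.\<close>
    moreover have "{e \<in> eigenvalues M. e < 0} = {} \<or> {e \<in> eigenvalues M. e < 0} = {b}"
      using ev \<open>0 < c\<close> by fastforce
    ultimately show ?thesis by (elim disjE) (simp_all only: sum.empty sum.insert finite.emptyI empty_iff simp_thms add_0_right)
  qed
  ultimately show ?thesis
    using \<open>0 \<le> lam\<close> \<open>0 \<le> Lam\<close> unfolding pucci_minus_def c_def[symmetric]
    by (intro add_mono mult_left_mono)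
qed

section \<open>Derivatives of the barrier\<close>

text \<open>Second-order chain rule: \<open>blinfun_scaleR_left (g' z) o\<^sub>L g' z\<close> is the
  tensor square of \<open>g' z\<close>, sending \<open>w\<close> to
  \<open>g' z w *\<^sub>R g' z\<close>. The profile is constrained only at values of
  \<open>g\<close>, since it is available only on a half-line.\<close>

lemma C2_derivs_compose:
  assumes g: "C2_derivs Q g g' g''"
    and h: "\<And>z. z \<in> Q \<Longrightarrow> (h has_real_derivative h' (g z)) (at (g z))"
    and h': "\<And>z. z \<in> Q \<Longrightarrow> (h' has_real_derivative h'' (g z)) (at (g z))"
    and h'': "\<And>z. z \<in> Q \<Longrightarrow> isCont h'' (g z)"
  shows "C2_derivs Q (\<lambda>z. h (g z)) (\<lambda>z. h' (g z) *\<^sub>R g' z)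
    (\<lambda>z. h'' (g z) *\<^sub>R (blinfun_scaleR_left (g' z) o\<^sub>L g' z) + h' (g z) *\<^sub>R g'' z)"
proof -
  have dg: "(g has_derivative blinfun_apply (g' z)) (at z within Q)" if "z \<in> Q" for z
    using g that by (simp add: C2_derivs_def)
  have dg': "(g' has_derivative blinfun_apply (g'' z)) (at z within Q)" if "z \<in> Q" for z
    using g that by (simp add: C2_derivs_def)
  have cg: "continuous_on Q g" by (rule has_derivative_continuous_on[OF dg])
  have cg': "continuous_on Q g'" by (rule has_derivative_continuous_on[OF dg'])
  have cg'': "continuous_on Q g''" using g by (simp add: C2_derivs_def)
  have comp: "continuous_on Q (\<lambda>z. k (g z))" if "\<And>z. z \<in> Q \<Longrightarrow> isCont k (g z)" for k :: "real \<Rightarrow> real"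
    by (rule continuous_on_compose2[OF continuous_at_imp_continuous_on[of "g ` Q"] cg])
       (use that in auto)
  have dhg: "((\<lambda>z. h (g z)) has_derivative (\<lambda>w. h' (g z) * g' z w)) (at z within Q)"
    if "z \<in> Q" for z
    using has_derivative_compose[OF dg[OF that], of h "(*) (h' (g z))"] h[OF that]
    by (simp add: has_field_derivative_def)
  have dh'g: "((\<lambda>z. h' (g z)) has_derivative (\<lambda>w. h'' (g z) * g' z w)) (at z within Q)"
    if "z \<in> Q" for z
    using has_derivative_compose[OF dg[OF that], of h' "(*) (h'' (g z))"] h'[OF that]
    by (simp add: has_field_derivative_def)
  show ?thesis
    unfolding C2_derivs_def
  proof (intro conjI ballI)
    fix z assume z: "z \<in> Q"
    show "((\<lambda>z. h (g z)) has_derivative blinfun_apply (h' (g z) *\<^sub>R g' z)) (at z within Q)"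
      using dhg[OF z] by (simp add: scaleR_blinfun.rep_eq)
    show "((\<lambda>z. h' (g z) *\<^sub>R g' z) has_derivative
        blinfun_apply (h'' (g z) *\<^sub>R (blinfun_scaleR_left (g' z) o\<^sub>L g' z) + h' (g z) *\<^sub>R g'' z))
        (at z within Q)"
      by (rule has_derivative_eq_rhs[OF has_derivative_scaleR[OF dh'g[OF z] dg'[OF z]]])
         (simp add: fun_eq_iff blinfun.bilinear_simps)
  next
    have "continuous_on Q (\<lambda>z. h'' (g z))" by (rule comp[OF h''])
    moreover have "continuous_on Q (\<lambda>z. h' (g z))"
      by (rule comp[OF DERIV_isCont[OF h']])
    moreover have "continuous_on Q (\<lambda>z. blinfun_scaleR_left (g' z))"
      by (rule bounded_linear.continuous_on[OF bounded_linear_blinfun_scaleR_left cg'])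
    ultimately show "continuous_on Q
        (\<lambda>z. h'' (g z) *\<^sub>R (blinfun_scaleR_left (g' z) o\<^sub>L g' z) + h' (g z) *\<^sub>R g'' z)"
      using cg' cg''
      by (intro continuous_intros)
  qed
qed

lemma C2_derivs_quadratic:
  fixes x0 :: "real ^ 'n" and R K :: real
  obtains g' g'' where
    "C2_derivs Q (\<lambda>z. R - (norm (fst z - x0))\<^sup>2 - K * (snd z)\<^sup>2) g' g''"
    "\<And>z w. blinfun_apply (g' z) w = - 2 * ((fst z - x0) \<bullet> fst w) - 2 * K * snd z * snd w"
    "\<And>z w w'. blinfun_apply (blinfun_apply (g'' z) w) w' = - 2 * (fst w \<bullet> fst w') - 2 * K * snd w * snd w'"
proof -
  \<comment> \<open>The first derivative is affine in \<open>z\<close>, namely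
    \<open>G (z - (x0, 0))\<close>, so the linear map \<open>G\<close> is itself the constant second
    derivative.\<close>
  define G :: "(real ^ 'n) \<times> real \<Rightarrow> (((real ^ 'n) \<times> real) \<Rightarrow>\<^sub>L real)" where
    "G = (\<lambda>w. blinfun_inner_right (- 2 *\<^sub>R fst w, - 2 * K * snd w))"
  have G: "blinfun_apply (G w) w' = - 2 * (fst w \<bullet> fst w') - 2 * K * snd w * snd w'" for w w'
    by (simp add: G_def inner_prod_def)
  have "bounded_linear (\<lambda>w::(real ^ 'n) \<times> real. (- 2 *\<^sub>R fst w, - 2 * K * snd w))"
    unfolding linear_conv_bounded_linear[symmetric]
    by (intro linearI) (simp_all add: algebra_simps)
  then have bl: "bounded_linear G"
    unfolding G_def by (rule bounded_linear_compose[OF bounded_linear_blinfun_inner_right])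
  have "C2_derivs Q (\<lambda>z. R - (norm (fst z - x0))\<^sup>2 - K * (snd z)\<^sup>2)
      (\<lambda>z. G (z - (x0, 0))) (\<lambda>z. Blinfun G)"
    unfolding C2_derivs_def
  proof (intro conjI ballI)
    fix z assume "z \<in> Q"
    show "((\<lambda>z. R - (norm (fst z - x0))\<^sup>2 - K * (snd z)\<^sup>2) has_derivative
        blinfun_apply (G (z - (x0, 0)))) (at z within Q)"
      unfolding power2_norm_eq_inner
      by (rule has_derivative_eq_rhs, (rule derivative_intros)+)
         (simp add: G fun_eq_iff inner_commute algebra_simps)
    have "((\<lambda>z. G (z - (x0, 0))) has_derivative (\<lambda>w. G w)) (at z within Q)"
      by (rule bounded_linear.has_derivative[OF bl])
         (rule has_derivative_diff[OF has_derivative_ident has_derivative_const, simplified])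
    then show "((\<lambda>z. G (z - (x0, 0))) has_derivative blinfun_apply (Blinfun G)) (at z within Q)"
      using bl by (simp add: bounded_linear_Blinfun_apply)
  qed (rule continuous_on_const)
  then show ?thesis
    by (rule that) (auto simp: G bounded_linear_Blinfun_apply[OF bl])
qed

text \<open>Passes from the bilinear form on spatial directions to the matrix action required by the
  Pucci estimate.\<close>

lemma hess_rank_one_mult:
  fixes B :: "((real ^ 'n) \<times> real) \<Rightarrow>\<^sub>L (((real ^ 'n) \<times> real) \<Rightarrow>\<^sub>L real)"
  assumes "\<And>w w'. blinfun_apply (blinfun_apply B (w, 0)) (w', 0) = a * (v \<bullet> w) * (v \<bullet> w') + b * (w \<bullet> w')"
  shows "hess_x B *v w = (a * (v \<bullet> w)) *\<^sub>R v + b *\<^sub>R w"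
proof -
  have "hess_x B $ i $ j = a * v $ i * v $ j + (if i = j then b else 0)" for i j
    using inner_axis_axis[of i "1::real" j 1] by (simp add: hess_x_def assms inner_axis)
  then have "(hess_x B *v w) $ i = (\<Sum>j\<in>UNIV. a * v $ i * (v $ j * w $ j) + (if i = j then b * w $ j else 0))" for i
    by (auto simp: matrix_vector_mult_def algebra_simps intro!: sum.cong)
  then have "(hess_x B *v w) $ i = a * v $ i * (v \<bullet> w) + b * w $ i" for i
    by (simp add: sum.distrib inner_vec_def sum_distrib_left)
  then show ?thesis by (simp add: vec_eq_iff)
qed

section \<open>Propagation of the zero by the barrier\<close>

theorem corollary1p5:
  fixes lam Lam :: real
    and \<phi> \<eta> :: "real \<Rightarrow> real"
    and u :: "(real ^ 'n) \<times> real \<Rightarrow> real"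
  assumes "0 < lam" and "lam \<le> Lam"
    and "admissible_nonlinearity \<phi> \<eta>"
    and "osgood \<phi>"
    and "continuous_on (par_cube 4 (0, 1)) u"
    and "\<forall>z \<in> par_cube 4 (0, 1). 0 \<le> u z"
    and "viscosity_supersolution lam Lam \<phi> (par_cube 4 (0, 1)) u"
    and "viscosity_subsolution lam Lam \<phi> (par_cube 4 (0, 1)) u"
    and "u (0, 0) = 0"
  shows "\<forall>x \<in> ball 0 1. u (x, 0) = 0"
proof (rule ccontr)
  let ?Q = "par_cube 4 (0, 1) :: ((real ^ 'n) \<times> real) set"
  let ?n = "real CARD('n)"
  assume "\<not> ?thesis"
  then obtain x1 where x1: "norm x1 < 1" and "u (x1, 0) \<noteq> 0" by auto
  \<comment> \<open>The cube covers the times \<open>-15 < t \<le> 1\<close>, so only the upper end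
    restricts the size of \<open>t\<close>.\<close>
  have in_Q: "(x, t) \<in> ?Q" if "norm x < 4" "\<bar>t\<bar> \<le> 1" for x t
    using that infnorm_le_norm[of x] by (auto simp: par_cube_def)
  have nonneg: "0 \<le> u z" if "z \<in> ?Q" for z using assms(6) that by blast
  have x1_Q: "(x1, 0) \<in> ?Q" by (rule in_Q) (use x1 in auto)
  \<comment> \<open>This one constant bounds \<open>u\<close> from below near \<open>(x1, 0)\<close>
    and the slope of the profile from above, hence also the barrier.\<close>
  define c where "c = u (x1, 0) / 2"
  have "0 < c" using nonneg[OF x1_Q] \<open>u (x1, 0) \<noteq> 0\<close> by (simp add: c_def)
  then obtain d where "0 < d" and d: "\<And>z. z \<in> ?Q \<Longrightarrow> dist z (x1, 0) < d \<Longrightarrow> dist (u z) (u (x1, 0)) < c"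
    using assms(5) x1_Q unfolding continuous_on_iff by blast
  \<comment> \<open>Two thirds keep \<open>norm (x - x1) + \<bar>t\<bar>\<close> below
    \<open>d\<close>; the cap 1 on \<open>del\<close> keeps the ellipsoid inside the cube.\<close>
  define a where "a = d / 3"
  define del where "del = min (d / 3) 1"
  have a: "0 < a" and del: "0 < del" "del \<le> 1" using \<open>0 < d\<close> by (auto simp: a_def del_def)
  have near: "c < u (x, t)" if "(x, t) \<in> ?Q" "norm (x - x1) \<le> a" "\<bar>t\<bar> \<le> del" for x t
  proof -
    have "dist (x, t) (x1, 0) \<le> norm (x - x1) + \<bar>t\<bar>"
      using norm_Pair_le[of "x - x1" t] by (simp add: dist_norm)
    also have "\<dots> < d" using that \<open>0 < d\<close> by (simp add: a_def del_def)
    finally have "\<bar>u (x, t) - 2 * c\<bar> < c" using d[OF that(1)] by (simp add: dist_real_def c_def)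
    then show ?thesis by linarith
  qed
  have "x1 \<noteq> 0" using \<open>u (x1, 0) \<noteq> 0\<close> assms(9) by auto
  define R where "R = (norm x1)\<^sup>2"
  have R: "0 < R" "R < 1"
    using \<open>x1 \<noteq> 0\<close> x1 by (simp_all add: R_def abs_square_less_1)
  \<comment> \<open>Makes \<open>del\<close> the half-height of the ellipsoid \<open>E\<close> in
    time.\<close>
  define K where "K = R / del\<^sup>2"
  have "0 < K" using R del by (simp add: K_def)
  define g where "g = (\<lambda>z. R - (norm (fst z - x1))\<^sup>2 - K * (snd z)\<^sup>2)"
  define E where "E = {z. 0 \<le> g z}"
  \<comment> \<open>The bound is global, so a profile on \<open>y < 1\<close> gives a barrier on the
    whole cube.\<close>
  have g_less: "g z < 1" for z
    using R \<open>0 < K\<close> by (simp add: g_def) (smt (verit) mult_nonneg_nonneg zero_le_power2)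
  have E_bound: "norm (x - x1) \<le> norm x1" "\<bar>t\<bar> \<le> del" if "(x, t) \<in> E" for x t
  proof -
    have le: "(norm (x - x1))\<^sup>2 + K * t\<^sup>2 \<le> R" using that by (simp add: E_def g_def)
    moreover have "0 \<le> K * t\<^sup>2" using \<open>0 < K\<close> by simp
    ultimately have "(norm (x - x1))\<^sup>2 \<le> (norm x1)\<^sup>2" unfolding R_def by linarith
    then show "norm (x - x1) \<le> norm x1" by (rule power2_le_imp_le) simp
    have "K * t\<^sup>2 \<le> R" using le zero_le_power2[of "norm (x - x1)"] by linarith
    then have "t\<^sup>2 \<le> del\<^sup>2" using R del by (simp add: K_def field_simps)
    then show "\<bar>t\<bar> \<le> del" using del by (simp add: abs_le_square_iff[symmetric])
  qed
  have E_norm: "norm x \<le> 2" "\<bar>t\<bar> \<le> 1" if "(x, t) \<in> E" for x t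
    using E_bound[OF that] x1 del norm_triangle_sub[of x x1] by linarith+
  have E_Q: "E \<subseteq> ?Q"
    using E_norm by (force intro: in_Q)
  have phi_le: "t \<le> \<phi> t" if "0 \<le> t" for t
    using assms(3) that by (simp add: admissible_nonlinearity_def cond_P1_def)
  have phi_mono: "\<phi> s \<le> \<phi> t" if "0 \<le> s" "s \<le> t" for s t
    using assms(3) that by (auto simp: admissible_nonlinearity_def cond_P1_def mono_on_def)
  have phi_pos: "0 < \<phi> t" if "0 < t" for t using phi_le[of t] that by simp
  have phi_cont: "isCont \<phi> t" if "0 < t" for t
    using assms(3) that
    by (intro isCont_of_local_lipschitz) (simp_all add: admissible_nonlinearity_def cond_P1_def)
  \<comment> \<open>\<open>C * p\<close> dominates the unfavourable terms:
    \<open>2 * lam + 2 * Lam * ?n\<close> comes from the Hessian of \<open>g\<close>,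
    \<open>2 * K * del\<close> from the time derivative.\<close>
  define C where "C = 2 * lam + 2 * Lam * ?n + 2 * K * del"
  \<comment> \<open>Chosen so that \<open>lam * 4 * B * a\<^sup>2 = C + 1\<close>; the extra 1 pays
    for the gradient term.\<close>
  define B where "B = (C + 1) / (4 * lam * a\<^sup>2)"
  have C: "2 * lam \<le> C" using assms(1,2) \<open>0 < K\<close> del by (simp add: C_def)
  have "0 < B" using C assms(1) a by (simp add: B_def)
  obtain h h' where h0: "h 0 = 0"
    and h: "\<And>y. y < 1 \<Longrightarrow> (h has_real_derivative h' y) (at y)"
    and h': "\<And>y. y < 1 \<Longrightarrow> (h' has_real_derivative B * \<phi> (2 * h' y)) (at y)"
    and h'_bd: "\<And>y. y < 1 \<Longrightarrow> 0 < h' y \<and> h' y < c"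
    using osgood_profile[OF assms(4) phi_cont phi_pos \<open>0 < B\<close> \<open>0 < c\<close> zero_less_one] by blast
  have h_le: "h y \<le> c" if "0 \<le> y" "y < 1" for y
  proof (cases "y = 0")
    case False
    then obtain z where z: "0 < z" "z < y" "h y - h 0 = (y - 0) * h' z"
      using MVT2[of 0 y h h'] h \<open>0 \<le> y\<close> \<open>y < 1\<close> by auto
    have "y * h' z \<le> 1 * c"
      using z that h'_bd[of z] by (intro mult_mono) auto
    then show ?thesis using z h0 by simp
  qed (use h0 \<open>0 < c\<close> in simp)
  have h_neg: "h y < 0" if "y < 0" for y
  proof -
    obtain z where z: "y < z" "z < 0" "h 0 - h y = (0 - y) * h' z"
      using MVT2[of y 0 h h'] h \<open>y < 0\<close> by auto
    have "0 < (0 - y) * h' z" using z that h'_bd[of z] by (intro mult_pos_pos) auto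
    then show ?thesis using z h0 by simp
  qed

  \<comment> \<open>The minimum point of \<open>u - h \<circ> g\<close> on the ellipsoid\<close>
  have g_cont: "continuous_on S g" for S
    unfolding g_def by (intro continuous_intros)
  have hg_cont: "continuous_on S (\<lambda>z. h (g z))" for S
    by (rule continuous_on_compose2[OF _ g_cont, of "{..<1}"])
       (use h g_less in \<open>auto intro!: continuous_at_imp_continuous_on DERIV_isCont\<close>)
  have "compact E"
  proof -
    have "closed E"
      unfolding E_def by (intro closed_Collect_le continuous_on_const g_cont)
    moreover have "E \<subseteq> cball 0 2 \<times> cball 0 1" using E_norm by auto
    then have "bounded E" by (rule bounded_subset[OF bounded_Times[OF bounded_cball bounded_cball]])
    ultimately show ?thesis by (simp add: compact_eq_bounded_closed)
  qed
  have g0: "g (0, 0) = 0" by (simp add: g_def R_def)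
  then have E0: "(0, 0) \<in> E" by (simp add: E_def)
  have "continuous_on E (\<lambda>z. u z - h (g z))"
    by (intro continuous_on_diff hg_cont continuous_on_subset[OF assms(5) E_Q])
  then obtain zs where zs: "zs \<in> E" and min: "\<And>z. z \<in> E \<Longrightarrow> u zs - h (g zs) \<le> u z - h (g z)"
    using continuous_attains_inf[OF \<open>compact E\<close>] E0 by blast
  obtain x t where xt: "zs = (x, t)" by (cases zs)
  have xt_Q: "(x, t) \<in> ?Q" and xt_bd: "norm (x - x1) \<le> norm x1" "\<bar>t\<bar> \<le> del"
    using zs E_Q E_bound unfolding xt by blast+
  define m where "m = u zs - h (g zs)"
  have "m \<le> 0" using min[OF E0] g0 h0 assms(9) by (simp add: m_def)
  \<comment> \<open>Close to the axis \<open>u\<close> exceeds \<open>c\<close> while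
    \<open>h \<circ> g\<close> is at most \<open>c\<close>, so the difference would be positive
    there.\<close>
  have far: "a < norm (x - x1)"
  proof (rule ccontr)
    assume "\<not> ?thesis"
    then have "c < u zs" using near[OF xt_Q] xt_bd xt by simp
    moreover have "h (g zs) \<le> c" using h_le g_less zs by (simp add: E_def)
    ultimately show False using \<open>m \<le> 0\<close> by (simp add: m_def)
  qed

  \<comment> \<open>The test function touching \<open>u\<close> from below\<close>
  obtain g' g'' where g: "C2_derivs ?Q g g' g''"
    and g': "\<And>z w. blinfun_apply (g' z) w = - 2 * ((fst z - x1) \<bullet> fst w) - 2 * K * snd z * snd w"
    and g'': "\<And>z w w'. blinfun_apply (blinfun_apply (g'' z) w) w' = - 2 * (fst w \<bullet> fst w') - 2 * K * snd w * snd w'"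
    by (rule C2_derivs_quadratic[of ?Q R x1 K, folded g_def]) (rule that)
  define h'' where "h'' y = B * \<phi> (2 * h' y)" for y
  define \<psi>' where "\<psi>' = (\<lambda>z. h' (g z) *\<^sub>R g' z)"
  define \<psi>'' where "\<psi>'' = (\<lambda>z. h'' (g z) *\<^sub>R (blinfun_scaleR_left (g' z) o\<^sub>L g' z) + h' (g z) *\<^sub>R g'' z)"
  have h''_cont: "isCont h'' y" if "y < 1" for y
  proof -
    have "isCont (\<lambda>y. 2 * h' y) y" using DERIV_isCont[OF h'[OF that]] by (intro continuous_intros)
    then have "isCont (\<lambda>y. \<phi> (2 * h' y)) y"
      by (rule isCont_o2) (use phi_cont h'_bd[OF that] in simp)
    then show ?thesis unfolding h''_def by (intro continuous_intros)
  qed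
  have "C2_derivs ?Q (\<lambda>z. h (g z) + m) \<psi>' \<psi>''"
    unfolding \<psi>'_def \<psi>''_def
  \<comment> \<open>The additive constant \<open>m\<close> is absorbed into the profile.\<close>
  proof (rule C2_derivs_compose[OF g, of "\<lambda>y. h y + m"])
    fix z
    show "((\<lambda>y. h y + m) has_real_derivative h' (g z)) (at (g z))"
      using DERIV_add[OF h[OF g_less] DERIV_const[of m]] by simp
    show "(h' has_real_derivative h'' (g z)) (at (g z))"
      using h'[OF g_less] by (simp add: h''_def)
    show "isCont h'' (g z)" by (rule h''_cont[OF g_less])
  qed
  \<comment> \<open>Minimality gives this only on \<open>E\<close>; elsewhere the barrier is
    negative, \<open>m \<le> 0\<close> and \<open>u\<close> is nonnegative.\<close>
  moreover have "h (g w) + m \<le> u w" if "w \<in> ?Q" for w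
  proof (cases "w \<in> E")
    case True
    then show ?thesis using min[OF True] by (simp add: m_def)
  next
    case False
    then have "h (g w) < 0" by (intro h_neg) (simp add: E_def)
    then show ?thesis using \<open>m \<le> 0\<close> nonneg[OF that] by simp
  qed
  moreover have "h (g zs) + m = u zs" by (simp add: m_def)
  ultimately have visc: "pucci_minus lam Lam (hess_x (\<psi>'' zs)) - deriv_t (\<psi>' zs) \<le> \<phi> (norm (grad_x (\<psi>' zs)))"
    using assms(7) xt_Q xt unfolding viscosity_supersolution_def by blast

  \<comment> \<open>Violation of the supersolution inequality at the touching point\<close>
  define p where "p = h' (g zs)"
  define \<Phi> where "\<Phi> = \<phi> (2 * p)"
  define s where "s = (x - x1) \<bullet> (x - x1)"
  have p: "0 < p" using h'_bd[OF g_less] by (simp add: p_def)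
  have p_Phi: "2 * p \<le> \<Phi>" using phi_le p by (simp add: \<Phi>_def)
  have s: "a\<^sup>2 \<le> s"
    using far a by (simp add: s_def power2_norm_eq_inner[symmetric] power_mono)
  have "(C + 1) * \<Phi> = lam * (4 * (B * \<Phi>) * a\<^sup>2)"
    using assms(1) a by (simp add: B_def)
  also have "\<dots> \<le> lam * (4 * (B * \<Phi>) * s)"
    using s assms(1) \<open>0 < B\<close> p p_Phi by (intro mult_left_mono) auto
  finally have main: "(C + 1) * \<Phi> \<le> lam * (4 * (B * \<Phi>) * s)" .
  have hess: "hess_x (\<psi>'' zs) *v w = (4 * (B * \<Phi>) * ((x - x1) \<bullet> w)) *\<^sub>R (x - x1) + (- 2 * p) *\<^sub>R w" for w
    by (rule hess_rank_one_mult)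
       (simp add: \<psi>''_def blinfun.bilinear_simps g' g'' xt p_def \<Phi>_def h''_def algebra_simps)
  \<comment> \<open>Positivity of the eigenvalue in the direction \<open>x - x1\<close>, which puts
    the weight \<open>lam\<close> on it.\<close>
  have pos: "0 < 4 * (B * \<Phi>) * s + (- 2 * p)"
  proof -
    have "lam * (2 * p) \<le> lam * (2 * \<Phi>)" using p p_Phi assms(1) by (intro mult_left_mono) auto
    also have "\<dots> \<le> C * \<Phi>" using C p p_Phi mult_right_mono[OF C, of \<Phi>] by (simp add: mult_ac)
    also have "\<dots> < (C + 1) * \<Phi>" using p p_Phi by (simp add: algebra_simps)
    finally have "lam * (2 * p) < lam * (4 * (B * \<Phi>) * s)" using main by linarith
    then show ?thesis using assms(1) by simp
  qed
  have "lam * (4 * (B * \<Phi>) * s + (- 2 * p)) + Lam * (?n * (- 2 * p)) \<le> pucci_minus lam Lam (hess_x (\<psi>'' zs))"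
    unfolding s_def by (rule pucci_minus_rank_one_ge[OF hess]) (use p pos assms(1,2) in \<open>auto simp: s_def\<close>)
  moreover have "deriv_t (\<psi>' zs) = - (2 * K * t * p)"
    by (simp add: deriv_t_def \<psi>'_def blinfun.bilinear_simps g' xt p_def)
  moreover have "- (2 * K * t * p) \<le> 2 * K * del * p"
    using xt_bd(2) \<open>0 < K\<close> p mult_left_mono[of "- t" del "2 * K * p"] by (simp add: mult_ac)
  \<comment> \<open>Since \<open>norm (x - x1) \<le> norm x1 < 1\<close>, the gradient has length at
    most \<open>2 * p\<close>, the argument of \<open>\<phi>\<close> in the profile
    equation.\<close>
  moreover have "\<phi> (norm (grad_x (\<psi>' zs))) \<le> \<Phi>"
  proof -
    have "grad_x (\<psi>' zs) = (- 2 * p) *\<^sub>R (x - x1)"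
      by (simp add: grad_x_def \<psi>'_def blinfun.bilinear_simps g' xt p_def vec_eq_iff inner_axis algebra_simps)
    then have "norm (grad_x (\<psi>' zs)) = 2 * p * norm (x - x1)" using p by simp
    also have "\<dots> \<le> 2 * p * 1" using p xt_bd x1 by (intro mult_left_mono) auto
    finally show ?thesis unfolding \<Phi>_def by (intro phi_mono) auto
  qed
  \<comment> \<open>The left side of the viscosity inequality is at least
    \<open>(C + 1) * \<Phi> - C * p\<close>, which now exceeds \<open>\<Phi>\<close>, a bound for
    its right side.\<close>
  moreover have "C * p < C * \<Phi>"
    using C assms(1) p p_Phi by (intro mult_strict_left_mono) auto
  ultimately show False
    using visc main by (simp add: C_def algebra_simps)
qed

end
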